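(* The Lie algebra of $\mathrm{Iso}_{\mathrm{sub}}(\mathbb{S}^7_{\mathrm{H}})\cap O(8)$ coincides with $$\mathfrak{k}_6=\mathrm{span}_{\mathbb{R}}\big(\{A_iA_j : 1\le i<j\le6\}\cup\{A_7\}\big)\subset\mathfrak{so}(8).$$ In particular, $\dim\mathrm{Iso}_{\mathrm{sub}}(\mathbb{S}^7_{\mathrm{H}})\ge\dim\mathfrak{k}_6=16$.
   Context: Let $A_1,\dots,A_7\in\mathfrak{so}(8)$ be a fixed family of real skew-symmetric $8\times 8$ matrices with $A_iA_j+A_jA_i=-2\delta_{ij}I$ for $i,j=1,\dots,7$. $\mathbb{S}^7\subset\mathbb{R}^8$ is the unit sphere. $\mathbb{S}^7_{\mathrm{H}}=\mathbb{S}^7_{\mathrm{T},6}=(\mathbb{S}^7,\mathcal{D}_6,g)$ is the subriemannian (SR) manifold with distribution $(\mathcal{D}_6)_q=\mathrm{span}\{A_1q,\dots,A_6q\}$, i.e. the orthogonal complement of $A_7q$ in $T_q\mathbb{S}^7$ (the horizontal space of the Hopf fibration), and $g$ the restriction to $\mathcal{D}_6$ of the standard Riemannian metric of $\mathbb{S}^7$. An SR isometry of an SR manifold $(M,\mathcal{H},g)$ is a diffeomorphism $\Phi:M\to M$ with $d\Phi_q(\mathcal{H}_q)\subset\mathcal{H}_{\Phi(q)}$ and such that $d\Phi_q:(\mathcal{H}_q,g_q)\to(\mathcal{H}_{\Phi(q)},g_{\Phi(q)})$ is an isometry for every $q\in M$. $\mathrm{Iso}_{\mathrm{sub}}(M)$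 denotes the group of all SR isometries, which for the structures considered here is a Lie group. $O(8)$ acts on $\mathbb{S}^7$ by left multiplication, and its elements are identified with the induced diffeomorphisms of $\mathbb{S}^7$; the intersection $\mathrm{Iso}_{\mathrm{sub}}(\mathbb{S}^7_{\mathrm{H}})\cap O(8)$ is a closed (Lie) subgroup of $O(8)$. *)

theory Defs
  imports "HOL-Analysis.Analysis"
begin

section \<open>Smooth maps on subsets of Euclidean space\<close>

text \<open>\<open>Ck_on k f U\<close>: \<open>f\<close> is of class \<open>C\<^sup>k\<close> on the open set \<open>U\<close>. The recursion goes
  through directional derivatives so that the type of \<open>f\<close> does not change.\<close>

primrec Ck_on :: "nat \<Rightarrow> ('a::real_normed_vector \<Rightarrow> 'b::real_normed_vector) \<Rightarrow> 'a set \<Rightarrow> bool" where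
  "Ck_on 0 f U \<longleftrightarrow> continuous_on U f"
| "Ck_on (Suc k) f U \<longleftrightarrow> (\<forall>x\<in>U. f differentiable at x) \<and>
     (\<forall>v. Ck_on k (\<lambda>x. frechet_derivative f (at x) v) U)"

text \<open>A map on a subset of Euclidean space is smooth iff near each point it is the
  restriction of a \<open>C\<^sup>\<infinity>\<close> map of the ambient space; for embedded submanifolds this is
  smoothness in charts.\<close>

definition smooth_map_on :: "'a::real_normed_vector set \<Rightarrow> ('a \<Rightarrow> 'b::real_normed_vector) \<Rightarrow> bool" where
  "smooth_map_on M f \<longleftrightarrow>
     (\<forall>q\<in>M. \<exists>U F. open U \<and> q \<in> U \<and> (\<forall>k. Ck_on k F U) \<and> (\<forall>x\<in>U \<inter> M. F x = f x))"

definition diffeo_on :: "'a::real_normed_vector set \<Rightarrow> ('a \<Rightarrow> 'a) \<Rightarrow> bool" where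
  "diffeo_on M f \<longleftrightarrow> bij_betw f M M \<and> smooth_map_on M f \<and> smooth_map_on M (inv_into M f)"


section \<open>Subriemannian isometries\<close>

text \<open>\<open>M\<close> is an embedded submanifold with the induced metric and \<open>H q \<subseteq> T\<^sub>q M\<close> a
  distribution. The derivative of a smooth \<open>\<Phi> : M \<rightarrow> M\<close> within \<open>M\<close> exists, and although it is
  not unique as a linear map of the ambient space, it is unique on \<open>T\<^sub>q M\<close>, where it is
  \<open>d\<Phi>\<^sub>q\<close>; it is only evaluated there.

  Maps are taken extensional (\<open>undefined\<close> outside \<open>M\<close>), so that they correspond one-to-one
  to actual maps \<open>M \<rightarrow> M\<close>.\<close>

definition sr_isometries :: "'a::euclidean_space set \<Rightarrow> ('a \<Rightarrow> 'a set) \<Rightarrow> ('a \<Rightarrow> 'a) set" where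
  "sr_isometries M H = {\<Phi> \<in> extensional M. diffeo_on M \<Phi> \<and>
     (\<forall>q\<in>M. let d\<Phi> = frechet_derivative \<Phi> (at q within M) in
        d\<Phi> ` H q \<subseteq> H (\<Phi> q) \<and> (\<forall>v\<in>H q. \<forall>w\<in>H q. d\<Phi> v \<bullet> d\<Phi> w = v \<bullet> w))}"


section \<open>The Hopf structure on the 7-sphere\<close>

abbreviation S7 :: "(real^8) set" where
  "S7 \<equiv> sphere 0 1"

definition so :: "(real^'n^'n) set" where
  "so = {X. transpose X = - X}"

definition clifford_family :: "(nat \<Rightarrow> real^8^8) \<Rightarrow> bool" where
  "clifford_family A \<longleftrightarrow> (\<forall>i\<in>{1..7}. A i \<in> so) \<and>
     (\<forall>i\<in>{1..7}. \<forall>j\<in>{1..7}. A i ** A j + A j ** A i = (if i = j then - 2 else 0) *\<^sub>R mat 1)"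

definition D6 :: "(nat \<Rightarrow> real^8^8) \<Rightarrow> real^8 \<Rightarrow> (real^8) set" where
  "D6 A q = span {A i *v q | i. i \<in> {1..6}}"

definition Iso_sub_H :: "(nat \<Rightarrow> real^8^8) \<Rightarrow> (real^8 \<Rightarrow> real^8) set" where
  "Iso_sub_H A = sr_isometries S7 (D6 A)"

text \<open>\<open>Iso\<^sub>s\<^sub>u\<^sub>b \<inter> O(8)\<close>, as a set of matrices.\<close>

definition Iso_sub_H_O8 :: "(nat \<Rightarrow> real^8^8) \<Rightarrow> (real^8^8) set" where
  "Iso_sub_H_O8 A = {Q. orthogonal_matrix Q \<and> restrict ((*v) Q) S7 \<in> Iso_sub_H A}"

definition k6 :: "(nat \<Rightarrow> real^8^8) \<Rightarrow> (real^8^8) set" where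
  "k6 A = span ({A i ** A j | i j. 1 \<le> i \<and> i < j \<and> j \<le> 6} \<union> {A 7})"


section \<open>Lie algebra of a closed matrix group, dimension of a Lie group\<close>

definition matrix_exp :: "real^'n^'n \<Rightarrow> real^'n^'n" where
  "matrix_exp X = (\<Sum>k. (1 / fact k) *\<^sub>R (((**) X ^^ k) (mat 1)))"

text \<open>The usual description of the Lie algebra of a closed subgroup of \<open>GL(n, \<real>)\<close>.\<close>

definition lie_algebra_of :: "(real^'n^'n) set \<Rightarrow> (real^'n^'n) set" where
  "lie_algebra_of G = {X. \<forall>t::real. matrix_exp (t *\<^sub>R X) \<in> G}"

text \<open>The Lie group topology on \<open>Iso\<^sub>s\<^sub>u\<^sub>b\<close> is the compact-open topology, which on maps of the
  compact sphere is the topology of uniform convergence.\<close>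

definition Iso_sub_H_topology :: "(nat \<Rightarrow> real^8^8) \<Rightarrow> (real^8 \<Rightarrow> real^8) topology" where
  "Iso_sub_H_topology A =
     subtopology (mtopology_of (cfunspace (top_of_set S7) euclidean_metric)) (Iso_sub_H A)"

text \<open>\<open>X\<close> is a topological manifold of dimension \<open>n\<close>; for a Lie group this is its dimension,
  which only depends on the underlying topological manifold. The Hausdorff property and second
  countability are not repeated: they always hold for \<open>Iso_sub_H_topology\<close>.\<close>

definition has_manifold_dim :: "'a topology \<Rightarrow> nat \<Rightarrow> bool" where
  "has_manifold_dim X n \<longleftrightarrow>
     (\<forall>x\<in>topspace X. \<exists>U V. openin X U \<and> x \<in> U \<and> openin (Euclidean_space n) V \<and>
        subtopology X U homeomorphic_space subtopology (Euclidean_space n) V)"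

end

theory Submission
  imports Defs
begin

text \<open>An orthogonal \<open>Q\<close> is a subriemannian isometry iff it maps \<open>D6 A q\<close>, the orthogonal complement
  of \<open>q\<close> and \<open>A 7 q\<close>, into \<open>D6 A (Q q)\<close>. Differentiating this along \<open>exp (t X)\<close> at \<open>t = 0\<close> shows
  that \<open>(A 7 X - X A 7) q\<close> is orthogonal to every vector orthogonal to \<open>q\<close> and \<open>A 7 q\<close>; as it is
  itself such a vector, it vanishes. So the Lie algebra is the centralizer of \<open>A 7\<close> in \<open>so\<close>. The
  28 matrices \<open>A j\<close> and \<open>A i A j\<close> are pairwise orthogonal, hence a basis of \<open>so\<close>, and the 16 of
  them that commute with \<open>A 7\<close> span the centralizer. The Cayley transform embeds this
  16-dimensional space topologically into the isometry group, and invariance of dimension gives the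
  lower bound.\<close>

section \<open>The matrix exponential\<close>

lemma bounded_bilinear_matrix_mult:
  "bounded_bilinear ((**) :: real^'m^'n \<Rightarrow> real^'p^'m \<Rightarrow> real^'p^'n)"
  unfolding bilinear_conv_bounded_bilinear[symmetric] bilinear_def
  by (intro conjI allI linearI; simp add: matrix_matrix_mult_def vec_eq_iff sum.distrib
      sum_distrib_left algebra_simps)

interpretation matrix_mult: bounded_bilinear "(**) :: real^'m^'n \<Rightarrow> real^'p^'m \<Rightarrow> real^'p^'n"
  by (rule bounded_bilinear_matrix_mult)

abbreviation matrix_pow :: "real^'n^'n \<Rightarrow> nat \<Rightarrow> real^'n^'n" where
  "matrix_pow X k \<equiv> ((**) X ^^ k) (mat 1)"

lemma matrix_pow_scaleR: "matrix_pow (t *\<^sub>R X) k = t ^ k *\<^sub>R matrix_pow X k"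
  by (induction k) (simp_all add: matrix_mult.scaleR_left matrix_mult.scaleR_right)

text \<open>Comparison with the real exponential series of \<open>norm X * K\<close>, where
  \<open>K\<close> is the bound of matrix multiplication as a bilinear map.\<close>

lemma summable_matrix_exp:
  fixes X :: "real^'n^'n"
  shows "summable (\<lambda>k. (1 / fact k) *\<^sub>R matrix_pow X k)"
proof -
  obtain K where K: "K \<ge> 0" "\<And>(P :: real^'n^'n) (Q :: real^'n^'n). norm (P ** Q) \<le> norm P * norm Q * K"
    using matrix_mult.nonneg_bounded by blast
  let ?c = "norm X * K" and ?I = "mat 1 :: real^'n^'n"
  have pow: "norm (matrix_pow X k) \<le> ?c ^ k * norm ?I" for k
  proof (induction k)
    case (Suc k)
    have "norm (matrix_pow X (Suc k)) \<le> ?c * norm (matrix_pow X k)"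
      using K(2)[of X "matrix_pow X k"] by (simp add: mult_ac)
    also have "\<dots> \<le> ?c * (?c ^ k * norm ?I)"
      using Suc K(1) by (intro mult_left_mono) auto
    finally show ?case by (simp add: mult_ac)
  qed simp
  have "summable (\<lambda>k. inverse (fact k) * ?c ^ k * norm ?I)"
    by (intro summable_mult2 summable_exp)
  then show ?thesis
  proof (rule summable_comparison_test[rotated], intro exI allI impI)
    fix k :: nat
    show "norm ((1 / fact k) *\<^sub>R matrix_pow X k) \<le> inverse (fact k) * ?c ^ k * norm ?I"
      using mult_left_mono[OF pow[of k], of "inverse (fact k)"]
      by (simp add: divide_inverse mult_ac)
  qed
qed

lemma sums_matrix_exp: "(\<lambda>k. (t ^ k / fact k) *\<^sub>R matrix_pow X k) sums matrix_exp (t *\<^sub>R X)"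
  using summable_sums[OF summable_matrix_exp[of "t *\<^sub>R X"]]
  by (simp add: matrix_exp_def matrix_pow_scaleR)

lemma matrix_exp_0 [simp]: "matrix_exp 0 = mat 1"
proof -
  have "(\<lambda>k. (0 ^ k / fact k) *\<^sub>R matrix_pow (0 :: real^'a^'a) k) sums mat 1"
    using sums_finite[of "{0}" "\<lambda>k. (0 ^ k / fact k) *\<^sub>R matrix_pow (0 :: real^'a^'a) k"] by simp
  moreover have "(\<lambda>k. (0 ^ k / fact k) *\<^sub>R matrix_pow (0 :: real^'a^'a) k) sums matrix_exp 0"
    using sums_matrix_exp[of 0 "0 :: real^'a^'a"] by simp
  ultimately show ?thesis
    by (rule sums_unique2[symmetric])
qed

text \<open>The inner product with a fixed matrix \<open>b\<close> turns the exponential into an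
  everywhere convergent real power series, which can be differentiated termwise.\<close>

lemma has_vector_derivative_matrix_exp:
  "((\<lambda>t. matrix_exp (t *\<^sub>R X)) has_vector_derivative X ** matrix_exp (t *\<^sub>R X)) (at t)"
proof -
  have "((\<lambda>s. matrix_exp (s *\<^sub>R X) \<bullet> b) has_field_derivative (X ** matrix_exp (t *\<^sub>R X)) \<bullet> b) (at t)" for b
  proof -
    define c where "c k = matrix_pow X k \<bullet> b / fact k" for k
    have sums: "(\<lambda>k. c k * s ^ k) sums (matrix_exp (s *\<^sub>R X) \<bullet> b)" for s
      using bounded_linear.sums[OF bounded_linear_inner_left sums_matrix_exp, of s X b]
      by (simp add: c_def mult_ac)
    have "(\<lambda>k. (X ** ((t ^ k / fact k) *\<^sub>R matrix_pow X k)) \<bullet> b) sums ((X ** matrix_exp (t *\<^sub>R X)) \<bullet> b)"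
      by (intro bounded_linear.sums[OF bounded_linear_inner_left]
          bounded_linear.sums[OF matrix_mult.bounded_linear_right] sums_matrix_exp)
    \<comment> \<open>\<open>diffs\<close> shifts the index: (k+1) / (k+1)! = 1 / k!, and the extra
      factor \<open>X\<close> makes the (k+1)-st power.\<close>
    moreover have "(X ** ((t ^ k / fact k) *\<^sub>R matrix_pow X k)) \<bullet> b = diffs c k * t ^ k" for k
      by (simp add: diffs_def c_def matrix_mult.scaleR_right)
    ultimately have "(X ** matrix_exp (t *\<^sub>R X)) \<bullet> b = (\<Sum>k. diffs c k * t ^ k)"
      by (simp add: sums_iff)
    moreover have "(\<lambda>s. matrix_exp (s *\<^sub>R X) \<bullet> b) = (\<lambda>s. \<Sum>k. c k * s ^ k)"
      using sums by (auto simp: sums_iff)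
    ultimately show ?thesis
      using termdiffs_strong_converges_everywhere[of c t] sums by (auto simp: sums_iff)
  qed
  then show ?thesis
    unfolding has_vector_derivative_def
    by (subst has_derivative_componentwise_within)
       (auto simp: has_field_derivative_def mult_commute_abs)
qed

lemma matrix_exp_commute:
  assumes "X ** B = B ** X"
  shows "matrix_exp X ** B = B ** matrix_exp X"
proof -
  have "matrix_pow X k ** B = B ** matrix_pow X k" for k
    by (induction k) (simp_all add: matrix_mul_assoc[symmetric], metis assms matrix_mul_assoc)
  then have "(\<lambda>k. (1 / fact k) *\<^sub>R matrix_pow X k ** B) = (\<lambda>k. B ** ((1 / fact k) *\<^sub>R matrix_pow X k))"
    by (simp add: matrix_mult.scaleR_left matrix_mult.scaleR_right)
  moreover have "(\<lambda>k. (1 / fact k) *\<^sub>R matrix_pow X k ** B) sums (matrix_exp X ** B)"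
    using bounded_linear.sums[OF matrix_mult.bounded_linear_left sums_matrix_exp[of 1 X]] by simp
  moreover have "(\<lambda>k. B ** ((1 / fact k) *\<^sub>R matrix_pow X k)) sums (B ** matrix_exp X)"
    using bounded_linear.sums[OF matrix_mult.bounded_linear_right sums_matrix_exp[of 1 X]] by simp
  ultimately show ?thesis
    by (simp add: sums_unique2)
qed

section \<open>Skew-symmetric and orthogonal matrices\<close>

lemma uminus_matrix_vector_mult: "(- X) *v x = - (X *v x :: real^'n)"
  using matrix_vector_mult_diff_rdistrib[of 0 X x] by simp

lemma inner_skew_mult: "X \<in> so \<Longrightarrow> (X *v x) \<bullet> y = - (x \<bullet> (X *v y))"
  using dot_lmul_matrix[of x X y] transpose_matrix_vector[of X x]
    inner_minus_left[of "X *v x" y]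
  by (simp add: so_def uminus_matrix_vector_mult del: transpose_matrix_vector inner_minus_left)

lemma inner_skew_self: "X \<in> so \<Longrightarrow> x \<bullet> (X *v x) = 0"
  using inner_skew_mult[of X x x] by (simp add: inner_commute)

lemma orthogonal_matrix_iff_norm:
  fixes Q :: "real^'n^'n"
  shows "orthogonal_matrix Q \<longleftrightarrow> (\<forall>x. norm (Q *v x) = norm x)"
  using orthogonal_transformation_matrix[of "(*v) Q"]
  by (simp add: orthogonal_transformation matrix_vector_mul_linear)

text \<open>The curve f(t) = exp(tX) x satisfies f' = X f, so the derivative of f . f is 2 f . (X
  f), which vanishes for skew \<open>X\<close>.\<close>

lemma orthogonal_matrix_exp:
  assumes "X \<in> so"
  shows "orthogonal_matrix (matrix_exp X)"
  unfolding orthogonal_matrix_iff_norm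
proof
  fix x
  let ?f = "\<lambda>t. matrix_exp (t *\<^sub>R X) *v x"
  have f: "(?f has_vector_derivative X *v ?f t) (at t)" for t
  proof -
    have "bounded_linear (\<lambda>Y::real^'a^'a. Y *v x)"
      by (auto intro!: linear_conv_bounded_linear[THEN iffD1] linearI
          simp: matrix_vector_mult_add_rdistrib scaleR_matrix_vector_assoc)
    from bounded_linear.has_vector_derivative[OF this has_vector_derivative_matrix_exp, of X t]
    show ?thesis by (simp add: matrix_vector_mul_assoc)
  qed
  have "((\<lambda>t. ?f t \<bullet> ?f t) has_real_derivative 0) (at t)" for t
    using bounded_bilinear.has_vector_derivative[OF bounded_bilinear_inner f f, of t]
    by (simp add: inner_skew_self[OF assms] inner_commute has_real_derivative_iff_has_vector_derivative)
  then have "?f 1 \<bullet> ?f 1 = ?f 0 \<bullet> ?f 0"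
    by (intro DERIV_const_ratio_const DERIV_isconst_all) auto
  then show "norm (matrix_exp X *v x) = norm x"
    by (simp add: norm_eq)
qed

section \<open>Orthogonal maps as subriemannian isometries\<close>

lemma Ck_on_const: "Ck_on k (\<lambda>x. c) U"
  by (induction k arbitrary: c) simp_all

text \<open>The derivative at every point is \<open>g\<close> itself, so each directional derivative
  is a constant function.\<close>

lemma Ck_on_bounded_linear:
  assumes "bounded_linear g"
  shows "Ck_on k g U"
proof -
  have "(g has_derivative g) (at x)" for x
    by (rule bounded_linear_imp_has_derivative[OF assms])
  moreover from this have "frechet_derivative g (at x) = g" for x
    by (rule frechet_derivative_at[symmetric])
  ultimately show ?thesis
    by (cases k) (auto simp: Ck_on_const differentiable_def intro!: linear_continuous_on assms)
qed

lemma smooth_map_on_bounded_linear: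
  assumes "bounded_linear g" "\<And>x. x \<in> M \<Longrightarrow> f x = g x"
  shows "smooth_map_on M f"
  unfolding smooth_map_on_def
  using assms Ck_on_bounded_linear[OF assms(1)] by (metis IntE UNIV_I open_UNIV)

text \<open>The derivative within the sphere is only determined on tangent vectors; there it is found
  by differentiating along a great circle.\<close>

lemma frechet_derivative_restrict_sphere:
  fixes g :: "'a::euclidean_space \<Rightarrow> 'b::real_normed_vector"
  assumes g: "bounded_linear g" and q: "q \<in> sphere 0 1" and v: "v \<bullet> q = 0"
  shows "frechet_derivative (restrict g (sphere 0 1)) (at q within sphere 0 1) v = g v"
proof -
  let ?S = "sphere (0::'a) 1"
  let ?f = "restrict g ?S"
  let ?D = "frechet_derivative ?f (at q within ?S)"
  have fg: "(?f has_derivative g) (at q within ?S)"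
    by (rule has_derivative_transform[OF q _ bounded_linear_imp_has_derivative[OF g]]) simp
  then have fD: "(?f has_derivative ?D) (at q within ?S)"
    using differentiable_def frechet_derivative_works by blast
  have unit: "?D u = g u" if u: "u \<bullet> q = 0" "u \<bullet> u = 1" for u
  proof -
    define \<gamma> where "\<gamma> t = cos t *\<^sub>R q + sin t *\<^sub>R u" for t
    have "\<gamma> t \<bullet> \<gamma> t = 1" for t
      using u q by (simp add: \<gamma>_def norm_eq_1 inner_add_left inner_add_right inner_commute[of q u]
          flip: power2_eq_square)
    then have im: "range \<gamma> \<subseteq> ?S"
      by (auto simp: norm_eq_1)
    have \<gamma>: "(\<gamma> has_derivative (\<lambda>h. h *\<^sub>R u)) (at 0)"
      unfolding \<gamma>_def by (auto intro!: derivative_eq_intros)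
    have \<gamma>0: "\<gamma> 0 = q"
      by (simp add: \<gamma>_def)
    \<comment> \<open>Both \<open>?D\<close> and \<open>g\<close> are derivatives of
      \<open>?f\<close> within the sphere. After composition with the great circle they become
      derivatives at 0 on the real line, where uniqueness holds.\<close>
    have "((\<lambda>t. ?f (\<gamma> t)) has_derivative (\<lambda>h. F (h *\<^sub>R u))) (at 0)"
      if "(?f has_derivative F) (at q within ?S)" for F
      by (rule has_derivative_in_compose[OF \<gamma>]) (use has_derivative_subset[OF that im] in \<open>simp only: \<gamma>0\<close>)
    from has_derivative_unique[OF this[OF fD] this[OF fg]]
    have "?D (1 *\<^sub>R u) = g (1 *\<^sub>R u)"
      by meson
    then show ?thesis by simp
  qed
  have D: "linear ?D" and "linear g"
    using fD g by (auto intro: has_derivative_linear bounded_linear.linear)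
  show ?thesis
  proof (cases "v = 0")
    case True
    then show ?thesis
      using D \<open>linear g\<close> by (simp add: linear_0)
  next
    case False
    have "?D (v /\<^sub>R norm v) = g (v /\<^sub>R norm v)"
      using v False by (intro unit) (auto simp: dot_square_norm power2_eq_square)
    with False show ?thesis
      using D \<open>linear g\<close> by (simp add: linear_cmul)
  qed
qed

text \<open>The inverse is multiplication by \<open>transpose Q\<close>, so both directions are
  restrictions of linear maps.\<close>

lemma diffeo_on_orthogonal_sphere:
  fixes Q :: "real^'n^'n"
  assumes "orthogonal_matrix Q"
  shows "diffeo_on (sphere 0 1) (restrict ((*v) Q) (sphere 0 1))"
proof -
  let ?S = "sphere (0::real^'n) 1" and ?f = "restrict ((*v) Q) (sphere 0 1)"
  have n: "norm (Q *v x) = norm x" "norm (transpose Q *v x) = norm x" for x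
    using assms orthogonal_matrix_transpose[of Q] unfolding orthogonal_matrix_iff_norm by auto
  have inv: "transpose Q *v (Q *v x) = x" "Q *v (transpose Q *v x) = x" for x
    using assms unfolding orthogonal_matrix_def
    by (auto simp: matrix_vector_mul_assoc simp del: transpose_matrix_vector)
  have bij: "bij_betw ?f ?S ?S"
    by (rule bij_betw_byWitness[where f' = "(*v) (transpose Q)"])
       (use n inv in \<open>auto simp del: transpose_matrix_vector\<close>)
  have "inv_into ?S ?f x = transpose Q *v x" if "x \<in> ?S" for x
    using that n(2)[of x] inv(2)[of x] bij
    by (intro inv_into_f_eq) (auto simp: bij_betw_def simp del: transpose_matrix_vector)
  then show ?thesis
    unfolding diffeo_on_def
    by (intro conjI bij smooth_map_on_bounded_linear[OF matrix_vector_mul_bounded_linear[of Q]]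
        smooth_map_on_bounded_linear[OF matrix_vector_mul_bounded_linear[of "transpose Q"]]) auto
qed

section \<open>Clifford relations and the distribution\<close>

lemma orthogonal_family:
  fixes f :: "'i \<Rightarrow> 'a::euclidean_space"
  assumes "\<And>i. i \<in> I \<Longrightarrow> f i \<noteq> 0" "\<And>i j. i \<in> I \<Longrightarrow> j \<in> I \<Longrightarrow> i \<noteq> j \<Longrightarrow> f i \<bullet> f j = 0"
  shows "independent (f ` I)" "dim (f ` I) = card I"
proof -
  have "inj_on f I"
    using assms by (metis inj_onI inner_eq_zero_iff)
  moreover show ind: "independent (f ` I)"
    using assms by (intro pairwise_orthogonal_independent) (auto simp: pairwise_def orthogonal_def)
  ultimately show "dim (f ` I) = card I"
    by (simp add: dim_eq_card_independent card_image)
qed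

context
  fixes A :: "nat \<Rightarrow> real^8^8"
  assumes clifford: "clifford_family A"
begin

lemma clifford_skew: "i \<in> {1..7} \<Longrightarrow> A i \<in> so"
  using clifford by (simp add: clifford_family_def)

lemma clifford_square:
  assumes "i \<in> {1..7}"
  shows "A i ** A i = - mat 1"
proof -
  have "A i ** A i + A i ** A i = - 2 *\<^sub>R mat 1"
    using clifford assms by (simp add: clifford_family_def)
  then have "2 *\<^sub>R (A i ** A i) = 2 *\<^sub>R (- mat 1)"
    by (simp add: scaleR_2)
  then show ?thesis
    by (simp only: scaleR_cancel_left) auto
qed

lemma clifford_anticommute:
  assumes "i \<in> {1..7}" "j \<in> {1..7}" "i \<noteq> j"
  shows "A i ** A j = - (A j ** A i)"
proof -
  have "A i ** A j + A j ** A i = 0"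
    using clifford assms by (simp add: clifford_family_def)
  then show ?thesis by (simp add: eq_neg_iff_add_eq_0)
qed

lemma clifford_square_vector: "i \<in> {1..7} \<Longrightarrow> A i *v (A i *v x) = - x"
  by (simp add: matrix_vector_mul_assoc clifford_square uminus_matrix_vector_mult)

text \<open>By skewness the inner product equals - x . (A_i A_j x). This changes sign when i and j
  are swapped, whereas the inner product is symmetric.\<close>

lemma clifford_inner:
  assumes "i \<in> {1..7}" "j \<in> {1..7}" "i \<noteq> j"
  shows "(A i *v x) \<bullet> (A j *v x) = 0"
  using inner_skew_mult[OF clifford_skew, OF assms(1), of x "A j *v x"]
    inner_skew_mult[OF clifford_skew, OF assms(2), of x "A i *v x"]
    clifford_anticommute[OF assms]
  by (simp add: matrix_vector_mul_assoc uminus_matrix_vector_mult inner_commute)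

lemma clifford_orthogonal: "i \<in> {1..7} \<Longrightarrow> orthogonal_matrix (A i)"
  using inner_skew_mult[OF clifford_skew, of i "x" "A i *v x" for x]
  by (simp add: orthogonal_matrix_iff_norm norm_eq clifford_square_vector)

text \<open>The vectors q, A_1 q, ..., A_7 q are nonzero and pairwise orthogonal, hence a basis of
  the 8-dimensional space. This form turns membership into two scalar equations, of which the second
  is later differentiated.\<close>

lemma D6_eq:
  assumes q: "q \<in> S7"
  shows "D6 A q = {v. v \<bullet> q = 0 \<and> v \<bullet> (A 7 *v q) = 0}"
proof
  have D6: "D6 A q = span ((\<lambda>i. A i *v q) ` {1..6})"
    unfolding D6_def by (rule arg_cong[of _ _ span]) auto
  have "(A i *v q) \<bullet> q = 0 \<and> (A i *v q) \<bullet> (A 7 *v q) = 0" if "i \<in> {1..6}" for i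
    using that clifford_inner[of i 7 q] inner_skew_self[OF clifford_skew, of i q]
    by (auto simp: inner_commute)
  moreover have "subspace {v. v \<bullet> q = 0 \<and> v \<bullet> (A 7 *v q) = 0}"
    by (auto simp: subspace_def inner_add_left)
  ultimately show sub: "D6 A q \<subseteq> {v. v \<bullet> q = 0 \<and> v \<bullet> (A 7 *v q) = 0}"
    unfolding D6 by (intro span_minimal) auto
  \<comment> \<open>Index 0 stands for \<open>q\<close>, so that the whole basis becomes one
    family.\<close>
  define f where "f i = (if i = 0 then q else A i *v q)" for i
  have "f i \<bullet> f j = 0" if "i \<in> {0..7}" "j \<in> {0..7}" "i \<noteq> j" for i j
    using that clifford_inner[of i j q] inner_skew_self[OF clifford_skew, of i q]
      inner_skew_self[OF clifford_skew, of j q]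
    by (auto simp: f_def inner_commute)
  moreover have "f i \<noteq> 0" if "i \<in> {0..7}" for i
  proof -
    have "norm (f i) = norm q"
      using that clifford_orthogonal[of i] by (auto simp: f_def orthogonal_matrix_iff_norm)
    with q show ?thesis by auto
  qed
  ultimately have "dim (f ` {0..7}) = 8"
    using orthogonal_family[of "{0..7}" f] by auto
  then have full: "span (f ` {0..7}) = UNIV"
    using dim_eq_full[of "f ` {0..7}"] by simp
  show "{v. v \<bullet> q = 0 \<and> v \<bullet> (A 7 *v q) = 0} \<subseteq> D6 A q"
  proof
    fix v assume v: "v \<in> {v. v \<bullet> q = 0 \<and> v \<bullet> (A 7 *v q) = 0}"
    \<comment> \<open>The remainder \<open>z\<close> is orthogonal to A_1 q, ..., A_6 q by
      construction, and to \<open>q\<close> and \<open>A 7 *v q\<close> because \<open>v\<close> and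
      \<open>w\<close> both are.\<close>
    obtain w z where wz: "w \<in> D6 A q" "\<And>x. x \<in> D6 A q \<Longrightarrow> orthogonal z x" "v = w + z"
      unfolding D6 by (metis orthogonal_subspace_decomp_exists)
    have "z \<bullet> f i = 0" if i: "i \<in> {0..7}" for i
    proof -
      consider "i = 0" | "i = 7" | "i \<in> {1..6}" using i by fastforce
      then show ?thesis
      proof cases
        case 3
        then have "f i \<in> D6 A q"
          unfolding D6 by (intro span_base) (auto simp: f_def)
        then show ?thesis using wz(2) by (simp add: orthogonal_def)
      qed (use v sub wz(1,3) in \<open>auto simp: f_def inner_add_left\<close>)
    qed
    then have "z = 0"
      using orthogonal_to_span[of z "f ` {0..7}" z] by (force simp: full orthogonal_def)
    with wz show "v \<in> D6 A q" by simp
  qed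
qed

end

section \<open>The Lie algebra as a centralizer\<close>

lemma orthogonal_matrix_inner: "orthogonal_matrix Q \<Longrightarrow> (Q *v x) \<bullet> (Q *v y) = x \<bullet> (y :: real^'n)"
  using orthogonal_transformation_matrix[of "(*v) Q"]
  by (simp add: orthogonal_transformation_def matrix_vector_mul_linear)

lemma bounded_bilinear_matrix_vector_mult:
  "bounded_bilinear ((*v) :: real^'m^'n \<Rightarrow> real^'m \<Rightarrow> real^'n)"
  unfolding bilinear_conv_bounded_bilinear[symmetric] bilinear_def
  by (intro conjI allI linearI; simp add: matrix_vector_mult_def vec_eq_iff sum.distrib
      sum_distrib_left algebra_simps)

lemma soI:
  fixes X :: "real^'n^'n"
  assumes "\<And>x y. (X *v x) \<bullet> y + x \<bullet> (X *v y) = 0"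
  shows "X \<in> so"
proof -
  have "transpose X *v y = (- X) *v y" for y
  proof (rule vector_eq_ldot[THEN iffD1], rule allI)
    fix x
    show "x \<bullet> (transpose X *v y) = x \<bullet> (- X *v y)"
      using assms[of x y] dot_lmul_matrix[of y X x]
      by (simp add: uminus_matrix_vector_mult inner_commute)
  qed
  then show ?thesis
    by (simp add: so_def matrix_eq del: transpose_matrix_vector)
qed

lemma subspace_so: "subspace (so :: (real^'n^'n) set)"
proof -
  have "linear (\<lambda>X :: real^'n^'n. transpose X + X)"
    by (intro linearI) (simp_all add: transpose_def vec_eq_iff algebra_simps)
  from linear_subspace_kernel[OF this] show ?thesis
    by (simp add: so_def eq_neg_iff_add_eq_0)
qed

lemma deriv_matrix_exp_form:
  fixes X :: "real^'n^'n"
  shows "((\<lambda>t. (matrix_exp (t *\<^sub>R X) *v x) \<bullet> (B *v (matrix_exp (t *\<^sub>R X) *v y)))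
     has_real_derivative ((X *v x) \<bullet> (B *v y) + x \<bullet> (B *v (X *v y)))) (at 0)"
proof -
  have d: "((\<lambda>t. matrix_exp (t *\<^sub>R X) *v x) has_vector_derivative X *v x) (at 0)" for x
    using bounded_linear.has_vector_derivative[OF
        bounded_bilinear.bounded_linear_left[OF bounded_bilinear_matrix_vector_mult, of x]
        has_vector_derivative_matrix_exp, of X 0]
    by simp
  have "((\<lambda>t. B *v (matrix_exp (t *\<^sub>R X) *v y)) has_vector_derivative B *v (X *v y)) (at 0)"
    by (rule bounded_linear.has_vector_derivative[OF matrix_vector_mul_bounded_linear d])
  from bounded_bilinear.has_vector_derivative[OF bounded_bilinear_inner d this, of x]
  show ?thesis
    by (simp add: has_real_derivative_iff_has_vector_derivative add.commute)
qed

text \<open>Used twice: \<open>B = mat 1\<close> gives skewness of \<open>X\<close>, and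
  \<open>B = A 7\<close> linearizes the invariance of the distribution.\<close>

lemma deriv_matrix_exp_form_const:
  fixes X :: "real^'n^'n"
  assumes "\<And>t. (matrix_exp (t *\<^sub>R X) *v x) \<bullet> (B *v (matrix_exp (t *\<^sub>R X) *v y)) = c"
  shows "(X *v x) \<bullet> (B *v y) + x \<bullet> (B *v (X *v y)) = 0"
  using DERIV_unique[OF deriv_matrix_exp_form[of X x B y]] by (simp add: assms)

context
  fixes A :: "nat \<Rightarrow> real^8^8"
  assumes clifford: "clifford_family A"
begin

text \<open>On tangent vectors the differential is \<open>Q\<close> itself, which preserves inner
  products. Only the invariance of the distribution remains as a condition.\<close>

lemma Iso_sub_H_O8_iff:
  "Q \<in> Iso_sub_H_O8 A \<longleftrightarrow>
     orthogonal_matrix Q \<and> (\<forall>q\<in>S7. \<forall>v\<in>D6 A q. Q *v v \<in> D6 A (Q *v q))"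
proof (cases "orthogonal_matrix Q")
  case True
  let ?f = "restrict ((*v) Q) S7"
  have "frechet_derivative ?f (at q within S7) v = Q *v v" if "q \<in> S7" "v \<in> D6 A q" for q v
    using frechet_derivative_restrict_sphere[OF matrix_vector_mul_bounded_linear[of Q] that(1)] that
    by (auto simp: D6_eq[OF clifford that(1)])
  then have "?f \<in> Iso_sub_H A \<longleftrightarrow> (\<forall>q\<in>S7. \<forall>v\<in>D6 A q. Q *v v \<in> D6 A (Q *v q))"
    unfolding Iso_sub_H_def sr_isometries_def Let_def mem_Collect_eq
    by (auto simp: diffeo_on_orthogonal_sphere True orthogonal_matrix_inner image_subset_iff)
  with True show ?thesis
    by (simp add: Iso_sub_H_O8_def)
qed (simp add: Iso_sub_H_O8_def)

text \<open>Commuting with \<open>A 7\<close> means that \<open>Q\<close> maps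
  \<open>A 7 *v q\<close> to \<open>A 7 *v (Q *v q)\<close>; being orthogonal, \<open>Q\<close> then
  carries one orthogonal complement to the other.\<close>

lemma Iso_sub_H_O8I:
  assumes "orthogonal_matrix Q" "Q ** A 7 = A 7 ** Q"
  shows "Q \<in> Iso_sub_H_O8 A"
  unfolding Iso_sub_H_O8_iff
proof (intro conjI ballI assms(1))
  fix q v assume q: "q \<in> S7" and v: "v \<in> D6 A q"
  have Qq: "Q *v q \<in> S7"
    using q assms(1) by (simp add: orthogonal_matrix_iff_norm)
  have "A 7 *v (Q *v q) = Q *v (A 7 *v q)"
    by (simp add: matrix_vector_mul_assoc assms(2))
  with v show "Q *v v \<in> D6 A (Q *v q)"
    by (simp add: D6_eq[OF clifford q] D6_eq[OF clifford Qq] orthogonal_matrix_inner[OF assms(1)])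
qed

lemma lie_algebra_eq_centralizer:
  "lie_algebra_of (Iso_sub_H_O8 A) = {X \<in> so. X ** A 7 = A 7 ** X}"
proof (intro equalityI subsetI)
  fix X assume X: "X \<in> {X \<in> so. X ** A 7 = A 7 ** X}"
  have "matrix_exp (t *\<^sub>R X) \<in> Iso_sub_H_O8 A" for t
    using X
    by (intro Iso_sub_H_O8I orthogonal_matrix_exp matrix_exp_commute)
       (auto simp: subspace_scale[OF subspace_so] matrix_mult.scaleR_left matrix_mult.scaleR_right)
  then show "X \<in> lie_algebra_of (Iso_sub_H_O8 A)"
    by (simp add: lie_algebra_of_def)
next
  fix X assume "X \<in> lie_algebra_of (Iso_sub_H_O8 A)"
  then have G: "matrix_exp (t *\<^sub>R X) \<in> Iso_sub_H_O8 A" for t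
    by (simp add: lie_algebra_of_def)
  then have O: "orthogonal_matrix (matrix_exp (t *\<^sub>R X))" for t
    by (simp add: Iso_sub_H_O8_iff)
  have so: "X \<in> so"
    using deriv_matrix_exp_form_const[of X _ "mat 1"] orthogonal_matrix_inner[OF O]
    by (intro soI) simp
  have A7: "A 7 \<in> so" "orthogonal_matrix (A 7)"
    using clifford_skew[OF clifford] clifford_orthogonal[OF clifford] by auto
  have unit: "A 7 *v (X *v q) - X *v (A 7 *v q) = 0" (is "?w = 0") if q: "q \<in> S7" for q
  proof -
    have *: "v \<bullet> ?w = 0" if v: "v \<bullet> q = 0" "v \<bullet> (A 7 *v q) = 0" for v
    proof -
      have "matrix_exp (t *\<^sub>R X) *v v \<in> D6 A (matrix_exp (t *\<^sub>R X) *v q)" for t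
        using G[of t] q v D6_eq[OF clifford q] by (simp add: Iso_sub_H_O8_iff)
      moreover have "matrix_exp (t *\<^sub>R X) *v q \<in> S7" for t
        using O[of t] q by (simp add: orthogonal_matrix_iff_norm)
      \<comment> \<open>Along exp(tX) the image of \<open>v\<close> stays orthogonal to
        \<open>A 7\<close> applied to the image of \<open>q\<close>, so the form has the constant
        value 0.\<close>
      ultimately have "(X *v v) \<bullet> (A 7 *v q) + v \<bullet> (A 7 *v (X *v q)) = 0"
        by (intro deriv_matrix_exp_form_const[where c = 0]) (simp add: D6_eq[OF clifford])
      then show ?thesis
        by (simp add: inner_skew_mult[OF so] inner_diff_right)
    qed
    \<comment> \<open>The vector \<open>?w\<close> itself satisfies both conditions on
      \<open>v\<close>, so it may be inserted for \<open>v\<close>, which gives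
      \<open>?w \<bullet> ?w = 0\<close>.\<close>
    have "?w \<bullet> q = 0"
      using inner_skew_mult[OF so, of "A 7 *v q" q] inner_skew_mult[OF A7(1), of "X *v q" q]
      by (simp add: inner_diff_left inner_commute[of "X *v q" "A 7 *v q"])
    moreover have "?w \<bullet> (A 7 *v q) = 0"
      using inner_skew_self[OF so, of q] inner_skew_self[OF so, of "A 7 *v q"]
        inner_commute[of "X *v q" q] inner_commute[of "X *v (A 7 *v q)" "A 7 *v q"]
      by (simp add: inner_diff_left orthogonal_matrix_inner[OF A7(2)])
    ultimately show ?thesis
      using *[of ?w] by simp
  qed
  \<comment> \<open>The identity on unit vectors extends to all vectors by scaling.\<close>
  have "X ** A 7 *v x = A 7 ** X *v x" for x
  proof (cases "x = 0")
    case False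
    then have "A 7 *v (X *v (x /\<^sub>R norm x)) - X *v (A 7 *v (x /\<^sub>R norm x)) = 0"
      by (intro unit) simp
    with False show ?thesis
      by (simp add: matrix_vector_mul_assoc matrix_vector_mult_scaleR flip: scaleR_diff_right)
  qed simp
  with so show "X \<in> {X \<in> so. X ** A 7 = A 7 ** X}"
    by (simp add: matrix_eq)
qed

end

section \<open>Clifford monomials\<close>

text \<open>The square of the index set splits into the pairs above the diagonal, their mirror
  images and the diagonal.\<close>

lemma card_less_pairs:
  "2 * card {(i, j). i < (j :: 'n::{finite,linorder})} = CARD('n) * (CARD('n) - 1)"
proof -
  let ?D = "{(i, j). i < (j::'n)}"
  have "UNIV = ?D \<union> prod.swap ` ?D \<union> range (\<lambda>i. (i, i))"
    by (auto simp: image_iff)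
  moreover have "?D \<inter> prod.swap ` ?D = {}" "(?D \<union> prod.swap ` ?D) \<inter> range (\<lambda>i. (i, i)) = {}"
    by auto
  ultimately have "CARD('n \<times> 'n) = card ?D + card (prod.swap ` ?D) + card (range (\<lambda>i::'n. (i, i)))"
    by (metis (no_types, lifting) card_Un_disjoint finite)
  also have "card (prod.swap ` ?D) = card ?D"
    by (intro card_image inj_swap)
  also have "card (range (\<lambda>i::'n. (i, i))) = CARD('n)"
    by (intro card_image injI) simp
  finally show ?thesis
    by (simp add: algebra_simps)
qed

text \<open>A skew matrix is determined by its entries above the diagonal: the matrices
  \<open>E (a, b)\<close> with a < b, having 1 at (a, b) and -1 at (b, a), span
  \<open>so\<close>.\<close>

lemma dim_so_le:
  
  "2 * dim (so :: (real^('n::{finite,linorder})^('n::{finite,linorder})) set) \<le> CARD('n) * (CARD('n) - 1)"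
proof -
  let ?D = "{(i, j). i < (j::'n)}"
  define E :: "'n \<times> 'n \<Rightarrow> ((real, 'n) vec, 'n) vec" where
    "E p = (\<chi> a b. if p = (a, b) then 1 else if p = (b, a) then - 1 else 0)" for p
  have "X \<in> span (E ` ?D)" if "X \<in> so" for X
  proof -
    have X: "X $ a $ b = - X $ b $ a" for a b
    proof -
      have "transpose X $ b $ a = (- X) $ b $ a"
        using that by (simp only: so_def mem_Collect_eq)
      then show ?thesis
        by (simp add: transpose_def)
    qed
    have "(\<Sum>p\<in>?D. (X $ fst p $ snd p) *\<^sub>R E p) $ a $ b = X $ a $ b" for a b
    proof -
      \<comment> \<open>At most one summand survives, namely (a, b) or (b, a), whichever lies above
        the diagonal.\<close>
      have "(\<Sum>p\<in>?D. X $ fst p $ snd p * E p $ a $ b) =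
        (\<Sum>p\<in>?D. (if p = (a, b) then X $ a $ b else 0) + (if p = (b, a) then X $ a $ b else 0))"
      proof (intro sum.cong refl)
        fix p assume p: "p \<in> ?D"
        consider "p = (a, b)" | "p = (b, a)" "p \<noteq> (a, b)" | "p \<noteq> (a, b)" "p \<noteq> (b, a)"
          by blast
        then show "X $ fst p $ snd p * E p $ a $ b =
            (if p = (a, b) then X $ a $ b else 0) + (if p = (b, a) then X $ a $ b else 0)"
        proof cases
          case 1
          with p have "a \<noteq> b" by auto
          with 1 show ?thesis by (simp add: E_def)
        next
          case 2
          with p have "a \<noteq> b" by auto
          with 2 show ?thesis using X[of b a] by (simp add: E_def)
        qed (simp add: E_def)
      qed
      also have "\<dots> = (if a < b then X $ a $ b else 0) + (if b < a then X $ a $ b else 0)"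
        by (simp add: sum.distrib)
      also have "\<dots> = X $ a $ b"
        using X[of a a] by (cases a b rule: linorder_cases) (auto dest: order.asym)
      finally show ?thesis by (simp add: sum_component)
    qed
    then have "X = (\<Sum>p\<in>?D. (X $ fst p $ snd p) *\<^sub>R E p)"
      by (simp add: vec_eq_iff)
    then show ?thesis
      by (metis (no_types, lifting) imageI span_base span_scale span_sum)
  qed
  then have "dim (so :: ((real, 'n) vec, 'n) vec set) \<le> card (E ` ?D)"
    by (intro dim_le_card) auto
  also have "\<dots> \<le> card ?D"
    by (intro card_image_le) simp
  finally show ?thesis
    using card_less_pairs[where 'n = 'n] by linarith
qed

section \<open>The entrywise inner product of matrices\<close>

text \<open>The rows of \<open>M ** P\<close> are the rows of \<open>M\<close> transformed by the
  orthogonal matrix \<open>transpose P\<close>.\<close>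

lemma inner_matrix_mult_right:
  fixes M N P :: "real^'n^'n"
  assumes "orthogonal_matrix P"
  shows "(M ** P) \<bullet> (N ** P) = M \<bullet> N"
proof -
  have row: "(M ** P) $ i = transpose P *v M $ i" for M i
    by (simp add: vec_eq_iff matrix_matrix_mult_def vector_matrix_mult_def mult.commute)
  have "orthogonal_matrix (transpose P)"
    using assms by simp
  then show ?thesis
    unfolding inner_vec_def[of "M ** P"] inner_vec_def[of M] row
    by (simp only: orthogonal_matrix_inner)
qed

lemma inner_transpose: "transpose M \<bullet> transpose N = M \<bullet> (N :: real^'n^'m)"
  unfolding inner_vec_def transpose_def by (simp add: sum.swap[of _ "UNIV :: 'n set"])

lemma inner_matrix_mult_left:
  fixes M N P :: "real^'n^'n"
  assumes "orthogonal_matrix P"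
  shows "(P ** M) \<bullet> (P ** N) = M \<bullet> N"
  using inner_matrix_mult_right[of "transpose P" "transpose M" "transpose N"] assms
  by (simp add: inner_transpose flip: matrix_transpose_mul)

text \<open>Multiplication by \<open>P\<close> on either side preserves the inner product, so M . N
  = PM . PN = - (MP . NP) = - (M . N).\<close>

lemma inner_eq_0_if_commute_anticommute:
  fixes M N P :: "real^'n^'n"
  assumes "orthogonal_matrix P" "P ** M = M ** P" "P ** N = - (N ** P)"
  shows "M \<bullet> N = 0"
proof -
  have "M \<bullet> N = - (M \<bullet> N)"
    using inner_matrix_mult_left[OF assms(1), of M N] inner_matrix_mult_right[OF assms(1), of M N]
    by (simp add: assms)
  then show ?thesis by simp
qed

text \<open>The index \<open>i = 0\<close> encodes the absence of the first factor.\<close>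

definition clifford_monomial :: "(nat \<Rightarrow> real^8^8) \<Rightarrow> nat \<times> nat \<Rightarrow> real^8^8" where
  "clifford_monomial A = (\<lambda>(i, j). if i = 0 then A j else A i ** A j)"

text \<open>There are 7 pairs for the single matrices and 21 for the products, together 28, the
  dimension of so(8).\<close>

definition clifford_pairs :: "(nat \<times> nat) set" where
  "clifford_pairs = (SIGMA i:{0..6}. {i<..7})"

text \<open>Sign rule for moving A_l past a monomial: each factor with index different from l
  contributes -1, and a factor A_l contributes 1.\<close>

definition commutes_with :: "nat \<Rightarrow> nat \<times> nat \<Rightarrow> bool" where
  "commutes_with l = (\<lambda>(i, j). if i = 0 then l = j else l \<noteq> i \<and> l \<noteq> j)"

text \<open>The indices that commute with A_j form {j}, those that commute with A_i A_j form the
  five-element complement of {i, j} in {1..7}. These sets differ for distinct pairs.\<close>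

lemma commutes_with_separates:
  assumes "p \<in> clifford_pairs" "p' \<in> clifford_pairs" "p \<noteq> p'"
  obtains l where "l \<in> {1..7}" "commutes_with l p \<noteq> commutes_with l p'"
proof -
  obtain i j i' j' where p: "p = (i, j)" "p' = (i', j')" by (cases p, cases p')
  have ij: "i < j" "j \<le> 7" "i' < j'" "j' \<le> 7" "i \<noteq> i' \<or> j \<noteq> j'"
    using assms by (auto simp: p clifford_pairs_def)
  \<comment> \<open>Needed to compare A_j with a product not containing it: an index outside all
    three commutes with the product only.\<close>
  have avoid: "\<exists>l\<in>{1..7}. l \<notin> {a, b, c}" for a b c :: nat
  proof -
    have "card {a, b, c} < card {1..7::nat}"
      using card_insert_le_m1[of 3 "{b, c}" a] card_insert_le_m1[of 2 "{c}" b] by simp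
    then show ?thesis
      by (meson card_mono finite.intros not_less subsetI)
  qed
  consider "i = 0" "i' = 0" | "i = 0" "i' > 0" "j \<in> {i', j'}" | "i = 0" "i' > 0" "j \<notin> {i', j'}"
    | "i > 0" "i' = 0" "j' \<in> {i, j}" | "i > 0" "i' = 0" "j' \<notin> {i, j}"
    | "i > 0" "i' > 0" "i \<notin> {i', j'}" | "i > 0" "i' > 0" "i \<in> {i', j'}" "j \<notin> {i', j'}"
    using ij by force
  then show ?thesis
  proof cases
    case 3
    obtain l where "l \<in> {1..7}" "l \<notin> {j, i', j'}" using avoid by metis
    with 3 show ?thesis by (intro that[of l]) (auto simp: p commutes_with_def)
  next
    case 5
    obtain l where "l \<in> {1..7}" "l \<notin> {j', i, j}" using avoid by metis
    with 5 show ?thesis by (intro that[of l]) (auto simp: p commutes_with_def)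
  next
    case 6
    with ij show ?thesis by (intro that[of i]) (auto simp: p commutes_with_def)
  next
    case 4
    with ij show ?thesis by (intro that[of j']) (auto simp: p commutes_with_def)
  qed (use ij in \<open>auto simp: p commutes_with_def intro!: that[of j]\<close>)
qed

section \<open>Monomial bases of so(8) and k6\<close>

context
  fixes A :: "nat \<Rightarrow> real^8^8"
  assumes clifford: "clifford_family A"
begin

lemma clifford_monomial_commute:
  assumes "p \<in> clifford_pairs" "l \<in> {1..7}"
  shows "A l ** clifford_monomial A p =
    (if commutes_with l p then 1 else - 1) *\<^sub>R (clifford_monomial A p ** A l)"
proof -
  obtain i j where p: "p = (i, j)" "i < j" "j \<le> 7"
    using assms(1) by (auto simp: clifford_pairs_def)
  have anti: "A l ** A k = - (A k ** A l)" if "k \<in> {1..7}" "l \<noteq> k" for k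
    using clifford_anticommute[OF clifford assms(2) that] .
  show ?thesis
  proof (cases "i = 0")
    case True
    then show ?thesis
      using p anti[of j] by (auto simp: clifford_monomial_def commutes_with_def)
  next
    case False
    have "A l ** (A i ** A j) = (if l = i then 1 else - 1) *\<^sub>R (A i ** (A l ** A j))"
      using p False anti[of i] by (auto simp: matrix_mul_assoc matrix_mult.minus_left)
    moreover have "A l ** A j = (if l = j then 1 else - 1) *\<^sub>R (A j ** A l)"
      using p anti[of j] by auto
    ultimately show ?thesis
      using p False by (auto simp: clifford_monomial_def commutes_with_def matrix_mul_assoc
          matrix_mult.minus_right)
  qed
qed

lemma clifford_monomial_orthogonal_matrix:
  "p \<in> clifford_pairs \<Longrightarrow> orthogonal_matrix (clifford_monomial A p)"
  using clifford_orthogonal[OF clifford]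
  by (auto simp: clifford_pairs_def clifford_monomial_def intro!: orthogonal_matrix_mul)

lemma clifford_monomial_skew:
  assumes "p \<in> clifford_pairs"
  shows "clifford_monomial A p \<in> so"
proof -
  obtain i j where p: "p = (i, j)" "i < j" "j \<le> 7"
    using assms(1) by (auto simp: clifford_pairs_def)
  show ?thesis
  proof (cases "i = 0")
    case True
    with p show ?thesis
      using clifford_skew[OF clifford, of j] by (simp add: clifford_monomial_def)
  next
    case False
    with p show ?thesis
      using clifford_skew[OF clifford, of i] clifford_skew[OF clifford, of j]
        clifford_anticommute[OF clifford, of j i]
      by (simp add: clifford_monomial_def so_def matrix_transpose_mul matrix_mult.minus_left
          matrix_mult.minus_right)
  qed
qed

text \<open>For two distinct monomials some A_l commutes with one and anticommutes with the other,
  so they are orthogonal. Arbitrary subsets \<open>I\<close> are allowed in order to treat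
  \<open>so\<close> and \<open>k6\<close> together.\<close>

lemma clifford_monomial_basis:
  assumes "I \<subseteq> clifford_pairs"
  shows "independent (clifford_monomial A ` I)" "dim (clifford_monomial A ` I) = card I"
proof -
  have nonzero: "clifford_monomial A p \<noteq> 0" if "p \<in> I" for p
  proof
    assume "clifford_monomial A p = 0"
    then have "orthogonal_matrix (0 :: real^8^8)"
      using clifford_monomial_orthogonal_matrix[of p] that assms by auto
    then have "norm ((0 :: real^8^8) *v axis 1 1) = norm (axis 1 1 :: real^8)"
      by (simp only: orthogonal_matrix_iff_norm)
    then show False by (simp add: norm_axis_1)
  qed
  have orthogonal: "clifford_monomial A p \<bullet> clifford_monomial A p' = 0"
    if pp: "p \<in> I" "p' \<in> I" "p \<noteq> p'" for p p'
  proof -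
    obtain l where l: "l \<in> {1..7}" "commutes_with l p \<noteq> commutes_with l p'"
      by (rule commutes_with_separates[of p p']) (use pp assms in auto)
    note sep = inner_eq_0_if_commute_anticommute[OF clifford_orthogonal[OF clifford l(1)]]
    note comm = clifford_monomial_commute[OF _ l(1)]
    have P: "p \<in> clifford_pairs" "p' \<in> clifford_pairs"
      using pp assms by auto
    show ?thesis
    proof (cases "commutes_with l p")
      case True
      with l comm[OF P(1)] comm[OF P(2)] show ?thesis
        by (intro sep) simp_all
    next
      case False
      with l comm[OF P(1)] comm[OF P(2)] show ?thesis
        by (subst inner_commute, intro sep) simp_all
    qed
  qed
  show "independent (clifford_monomial A ` I)" "dim (clifford_monomial A ` I) = card I"
    using orthogonal_family[of I "clifford_monomial A", OF nonzero orthogonal] by simp_all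
qed

text \<open>The 28 independent monomials lie in \<open>so\<close>, whose dimension is at most 8 * 7
  / 2 = 28.\<close>

lemma so_eq_span: "so = span (clifford_monomial A ` clifford_pairs)"
proof
  have "card clifford_pairs = 28"
    by (simp add: clifford_pairs_def card_SigmaI eval_nat_numeral)
  then have "card (clifford_monomial A ` clifford_pairs) = 28"
    using clifford_monomial_basis[of clifford_pairs] dim_eq_card_independent by fastforce
  moreover have "dim (so :: (real^8^8) set) \<le> 28"
    using dim_so_le[where 'n = 8] by simp
  ultimately show "so \<subseteq> span (clifford_monomial A ` clifford_pairs)"
    using clifford_monomial_skew clifford_monomial_basis(1)[of clifford_pairs]
    by (intro card_ge_dim_independent) auto
  show "span (clifford_monomial A ` clifford_pairs) \<subseteq> so"
    by (intro span_minimal subspace_so) (auto intro: clifford_monomial_skew)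
qed

text \<open>By the sign rule, A_7 commutes with itself and with exactly those products that do not
  contain it.\<close>

lemma k6_eq_span: "k6 A = span (clifford_monomial A ` {p \<in> clifford_pairs. commutes_with 7 p})"
  unfolding k6_def
proof (rule arg_cong[of _ _ span], intro equalityI subsetI)
  fix M assume "M \<in> {A i ** A j | i j. 1 \<le> i \<and> i < j \<and> j \<le> 6} \<union> {A 7}"
  then consider i j where "M = A i ** A j" "1 \<le> i" "i < j" "j \<le> 6" | "M = A 7" by auto
  then show "M \<in> clifford_monomial A ` {p \<in> clifford_pairs. commutes_with 7 p}"
  proof cases
    case (1 i j)
    then show ?thesis
      by (intro image_eqI[of _ _ "(i, j)"])
         (auto simp: clifford_monomial_def clifford_pairs_def commutes_with_def)
  next
    case 2
    then show ?thesis
      by (intro image_eqI[of _ _ "(0, 7)"])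
         (auto simp: clifford_monomial_def clifford_pairs_def commutes_with_def)
  qed
qed (force simp: clifford_monomial_def clifford_pairs_def commutes_with_def split: if_splits)

lemma dim_k6: "dim (k6 A) = 16"
proof -
  have "{p \<in> clifford_pairs. commutes_with 7 p} = insert (0, 7) (SIGMA i:{1..5}. {i<..6})"
    by (auto simp: clifford_pairs_def commutes_with_def split: if_splits)
  moreover have "card (SIGMA i:{1..5::nat}. {i<..6}) = 15"
    by (simp add: card_SigmaI eval_nat_numeral)
  ultimately have "card {p \<in> clifford_pairs. commutes_with 7 p} = 16"
    by simp
  then show ?thesis
    using clifford_monomial_basis(2)[of "{p \<in> clifford_pairs. commutes_with 7 p}"]
    by (simp add: k6_eq_span)
qed

text \<open>Averaging over conjugation by \<open>A 7\<close> projects \<open>so\<close> onto the centralizer of \<open>A 7\<close>.\<close>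

lemma k6_eq_centralizer: "k6 A = {X \<in> so. X ** A 7 = A 7 ** X}"
proof
  let ?C = "{X \<in> so. X ** A 7 = A 7 ** X}" and ?e = "clifford_monomial A"
  have "subspace ?C"
    using subspace_so by (auto simp: subspace_def matrix_mult.add_left matrix_mult.add_right
        matrix_mult.scaleR_left matrix_mult.scaleR_right)
  then show "k6 A \<subseteq> ?C"
    unfolding k6_eq_span using clifford_monomial_skew clifford_monomial_commute[of _ 7]
    by (intro span_minimal) auto
  \<comment> \<open>Since the inverse of \<open>A 7\<close> is \<open>- A 7\<close>, conjugation of
    \<open>X\<close> by \<open>A 7\<close> is \<open>- (A 7 ** X ** A 7)\<close>. On monomials
    \<open>L\<close> is the identity or zero.\<close>
  define L where "L X = (1 / 2) *\<^sub>R (X - A 7 ** X ** A 7)" for X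
  have "linear L"
    unfolding L_def
    by (intro linearI) (simp_all add: matrix_mult.add_left matrix_mult.add_right
        matrix_mult.scaleR_left matrix_mult.scaleR_right algebra_simps)
  have sq: "M ** A 7 ** A 7 = - M" for M
    using clifford_square[OF clifford, of 7] by (simp add: matrix_mult.minus_right flip: matrix_mul_assoc)
  have "L (?e p) \<in> k6 A" if "p \<in> clifford_pairs" for p
  proof (cases "commutes_with 7 p")
    case True
    then have "L (?e p) = ?e p"
      using clifford_monomial_commute[of p 7] that by (simp add: L_def sq flip: scaleR_2)
    with True that show ?thesis
      by (auto simp: k6_eq_span intro: span_base)
  next
    case False
    then have "L (?e p) = 0"
      using clifford_monomial_commute[of p 7] that by (simp add: L_def sq matrix_mult.minus_left)
    then show ?thesis
      by (simp add: k6_def span_zero)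
  qed
  then have "L ` so \<subseteq> k6 A"
    unfolding so_eq_span linear_span_image[OF \<open>linear L\<close>, symmetric]
    by (intro span_minimal) (auto simp: k6_def)
  moreover have "L X = X" if "X \<in> ?C" for X
  proof -
    have "A 7 ** X = X ** A 7"
      using that by simp
    then show ?thesis
      by (simp add: L_def sq flip: scaleR_2)
  qed
  ultimately show "?C \<subseteq> k6 A"
    by force
qed

end

section \<open>The Cayley transform and the dimension bound\<close>

definition cayley_inv :: "real^'n^'n \<Rightarrow> real^'n^'n" where
  "cayley_inv X = matrix_inv (mat 1 - X)"

text \<open>This is the Cayley transform (I + X) (I - X)^(-1), rewritten so that the inverse is its
  only nontrivial ingredient. It is injective on all of \<open>so\<close>, in contrast to the
  exponential in general.\<close>

definition cayley :: "real^'n^'n \<Rightarrow> real^'n^'n" where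
  "cayley X = 2 *\<^sub>R cayley_inv X - mat 1"

text \<open>Pythagoras, as \<open>X *v x\<close> is orthogonal to \<open>x\<close>.\<close>

lemma norm_skew_add:
  assumes "X \<in> so"
  shows "(norm (x + X *v x))\<^sup>2 = (norm x)\<^sup>2 + (norm (X *v x))\<^sup>2"
    "(norm (x - X *v x))\<^sup>2 = (norm x)\<^sup>2 + (norm (X *v x))\<^sup>2"
  using inner_skew_self[OF assms, of x] inner_commute[of x "X *v x"]
  by (simp_all add: power2_norm_eq_inner inner_add_left inner_add_right inner_diff_left inner_diff_right)

text \<open>By Pythagoras the kernel of I - X is trivial for skew \<open>X\<close>.\<close>

lemma cayley_inv:
  assumes "X \<in> so"
  shows "(mat 1 - X) ** cayley_inv X = mat 1" "cayley_inv X ** (mat 1 - X) = mat 1"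
proof -
  have "x = 0" if "(mat 1 - X) *v x = 0" for x
    using norm_skew_add(2)[OF assms, of x] that
    by (simp add: matrix_vector_mult_diff_rdistrib)
  then have "invertible (mat 1 - X)"
    by (simp add: matrix_left_invertible_ker invertible_left_inverse)
  then have "(mat 1 - X) ** matrix_inv (mat 1 - X) = mat 1 \<and> matrix_inv (mat 1 - X) ** (mat 1 - X) = mat 1"
    unfolding invertible_def matrix_inv_def by (rule someI_ex)
  then show "(mat 1 - X) ** cayley_inv X = mat 1" "cayley_inv X ** (mat 1 - X) = mat 1"
    by (simp_all add: cayley_inv_def)
qed

text \<open>Writing v = (I - X) w turns norm estimates for the inverse into Pythagoras for
  \<open>w\<close>.\<close>

lemma cayley_inv_vector:
  assumes "X \<in> so"
  obtains w where "v = w - X *v w" "cayley_inv X *v v = w"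
proof (rule that[of "cayley_inv X *v v"])
  have "v = (mat 1 - X) *v (cayley_inv X *v v)"
    by (simp add: matrix_vector_mul_assoc cayley_inv[OF assms])
  then show "v = cayley_inv X *v v - X *v (cayley_inv X *v v)"
    by (simp add: matrix_vector_mult_diff_rdistrib)
qed simp

lemma norm_cayley_inv_le:
  assumes "X \<in> so"
  shows "norm (cayley_inv X *v v) \<le> norm v"
proof -
  obtain w where w: "v = w - X *v w" "cayley_inv X *v v = w"
    using cayley_inv_vector[OF assms] .
  have "(norm w)\<^sup>2 \<le> (norm v)\<^sup>2"
    unfolding w(1) by (simp add: norm_skew_add(2)[OF assms])
  then show ?thesis
    unfolding w(2) by (rule power2_le_imp_le) simp
qed

text \<open>The transform sends w - X w to w + X w, and both have the same norm.\<close>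

lemma orthogonal_matrix_cayley:
  assumes "X \<in> so"
  shows "orthogonal_matrix (cayley X)"
  unfolding orthogonal_matrix_iff_norm
proof
  fix v
  obtain w where w: "v = w - X *v w" "cayley_inv X *v v = w"
    using cayley_inv_vector[OF assms] .
  have "cayley X *v v = 2 *\<^sub>R w - v"
    by (simp add: cayley_def matrix_vector_mult_diff_rdistrib w(2) flip: scaleR_matrix_vector_assoc)
  also have "\<dots> = w + X *v w"
    by (simp add: w(1) scaleR_2)
  finally have "(norm (cayley X *v v))\<^sup>2 = (norm v)\<^sup>2"
    unfolding w(1) by (simp add: norm_skew_add[OF assms])
  then show "norm (cayley X *v v) = norm v"
    by simp
qed

lemma cayley_commute:
  assumes "X \<in> so" "X ** B = B ** X"
  shows "cayley X ** B = B ** cayley X"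
proof -
  let ?C = "cayley_inv X"
  have "?C ** B = ?C ** B ** ((mat 1 - X) ** ?C)"
    by (simp add: cayley_inv[OF assms(1)])
  also have "\<dots> = ?C ** (B ** (mat 1 - X)) ** ?C"
    by (simp add: matrix_mul_assoc)
  also have "B ** (mat 1 - X) = (mat 1 - X) ** B"
    by (simp add: matrix_mult.diff_left matrix_mult.diff_right assms(2))
  also have "?C ** ((mat 1 - X) ** B) ** ?C = B ** ?C"
    by (simp add: matrix_mul_assoc cayley_inv[OF assms(1)])
  finally show ?thesis
    by (simp add: cayley_def matrix_mult.diff_left matrix_mult.diff_right
        matrix_mult.scaleR_left matrix_mult.scaleR_right)
qed

lemma inj_on_cayley: "inj_on cayley so"
proof (rule inj_onI)
  fix X Y :: "real^'n^'n"
  assume so: "X \<in> so" "Y \<in> so" and "cayley X = cayley Y"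
  then have "cayley_inv X = cayley_inv Y"
    by (simp add: cayley_def)
  then have "mat 1 - X = (mat 1 - X) ** (cayley_inv X ** (mat 1 - Y))"
    by (simp add: cayley_inv[OF so(2)])
  also have "\<dots> = mat 1 - Y"
    by (simp add: matrix_mul_assoc cayley_inv[OF so(1)])
  finally show "X = Y" by simp
qed

text \<open>The resolvent identity (I - X)^(-1) - (I - Y)^(-1) = (I - X)^(-1) (X - Y) (I - Y)^(-1),
  in which both inverses are norm-nonincreasing.\<close>

lemma cayley_lipschitz:
  obtains K where "\<And>(X :: real^'n^'n) Y q. X \<in> so \<Longrightarrow> Y \<in> so \<Longrightarrow>
    norm (cayley X *v q - cayley Y *v q) \<le> K * norm (X - Y) * norm q"
proof -
  obtain K where K: "K \<ge> 0"
    "\<And>(M :: real^'n^'n) v. norm (M *v v) \<le> norm M * norm v * K"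
    using bounded_bilinear.nonneg_bounded[OF bounded_bilinear_matrix_vector_mult] by blast
  have "norm (cayley X *v q - cayley Y *v q) \<le> (2 * K) * norm (X - Y) * norm q"
    if so: "X \<in> so" "Y \<in> so" for X Y :: "real^'n^'n" and q
  proof -
    have "cayley_inv X ** ((X - Y) ** cayley_inv Y) =
        cayley_inv X ** ((mat 1 - Y) ** cayley_inv Y) - cayley_inv X ** (mat 1 - X) ** cayley_inv Y"
      by (simp add: matrix_mult.diff_left matrix_mult.diff_right matrix_mul_assoc)
    also have "\<dots> = cayley_inv X - cayley_inv Y"
      by (simp add: cayley_inv so)
    finally have "cayley X - cayley Y = 2 *\<^sub>R (cayley_inv X ** ((X - Y) ** cayley_inv Y))"
      by (simp add: cayley_def scaleR_diff_right)
    then have "cayley X *v q - cayley Y *v q =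
        2 *\<^sub>R (cayley_inv X *v ((X - Y) *v (cayley_inv Y *v q)))"
      by (simp add: matrix_vector_mul_assoc scaleR_matrix_vector_assoc
          flip: matrix_vector_mult_diff_rdistrib)
    then have "norm (cayley X *v q - cayley Y *v q) =
        2 * norm (cayley_inv X *v ((X - Y) *v (cayley_inv Y *v q)))"
      by simp
    also have "\<dots> \<le> 2 * norm ((X - Y) *v (cayley_inv Y *v q))"
      using norm_cayley_inv_le[OF so(1)] by simp
    also have "\<dots> \<le> 2 * (norm (X - Y) * norm (cayley_inv Y *v q) * K)"
      using K(2) by simp
    also have "\<dots> \<le> 2 * (norm (X - Y) * norm q * K)"
      using K(1) norm_cayley_inv_le[OF so(2)] by (intro mult_left_mono mult_right_mono) auto
    finally show ?thesis by (simp add: mult_ac)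
  qed
  then show ?thesis by (rule that)
qed

section \<open>The lower bound by invariance of dimension\<close>

text \<open>A chart around \<open>\<phi> 0\<close> composed with \<open>\<phi>\<close> is a
  continuous injection of a nonempty relatively open subset of \<open>W\<close> into an
  \<open>n\<close>-dimensional space, so invariance of dimension applies.\<close>

lemma has_manifold_dim_ge:
  fixes \<phi> :: "'a::euclidean_space \<Rightarrow> 'b"
  assumes X: "has_manifold_dim X n"
    and W: "subspace W"
    and \<phi>: "continuous_map (top_of_set W) X \<phi>" "inj_on \<phi> W"
  shows "dim W \<le> n"
proof (rule ccontr)
  assume "\<not> dim W \<le> n"
  \<comment> \<open>Under the contrary assumption there is room in \<open>'a\<close> for a copy of
    \<open>n\<close>-space, spanned by \<open>n\<close> standard basis vectors.\<close>
  then have "n \<le> DIM('a)"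
    using dim_subset_UNIV[of W] by simp
  then obtain B :: "'a set" where B: "B \<subseteq> Basis" "card B = n"
    using obtain_subset_with_card_n by metis
  have "finite B" using finite_subset[OF B(1)] by simp
  obtain b where b: "bij_betw b {..<n} B"
    using ex_bij_betw_nat_finite[OF \<open>finite B\<close>] unfolding B(2) atLeast0LessThan ..
  have 0: "0 \<in> W" by (simp add: W subspace_0)
  then have "\<phi> 0 \<in> topspace X"
    using \<phi>(1) by (auto simp: continuous_map_def)
  then obtain U V where U: "openin X U" "\<phi> 0 \<in> U"
      and "subtopology X U homeomorphic_space subtopology (Euclidean_space n) V"
    using X unfolding has_manifold_dim_def by blast
  then obtain h where h: "homeomorphic_map (subtopology X U) (subtopology (Euclidean_space n) V) h"
    using homeomorphic_space by blast
  have UX: "topspace (subtopology X U) = U"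
    using openin_subset[OF U(1)] by auto
  \<comment> \<open>Points of \<open>Euclidean_space n\<close> are sequences vanishing from index
    \<open>n\<close> on; \<open>\<psi>\<close> identifies them with \<open>span B\<close>.\<close>
  define \<psi> where "\<psi> y = (\<Sum>i<n. y i *\<^sub>R b i)" for y :: "nat \<Rightarrow> real"
  define S where "S = {x \<in> W. \<phi> x \<in> U}"
  define f where "f = \<psi> \<circ> h \<circ> \<phi>"
  have openS: "openin (top_of_set W) S"
    using openin_continuous_map_preimage[OF \<phi>(1) U(1)] by (simp add: S_def)
  then have "S \<subseteq> W" by (auto simp: S_def)
  have coord: "\<psi> y \<bullet> b i = y i" if "i < n" for y i
  proof -
    have "b j \<bullet> b i = (if j = i then 1 else 0)" if "j < n" for j
      using that \<open>i < n\<close> b B(1)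
      by (subst inner_Basis) (auto simp: bij_betw_def inj_on_def)
    then have "\<psi> y \<bullet> b i = (\<Sum>j<n. if j = i then y j else 0)"
      unfolding \<psi>_def inner_sum_left by (intro sum.cong) auto
    with that show ?thesis by simp
  qed
  have "inj_on \<psi> (topspace (Euclidean_space n))"
  proof (rule inj_onI)
    fix y z assume *: "y \<in> topspace (Euclidean_space n)" "z \<in> topspace (Euclidean_space n)" "\<psi> y = \<psi> z"
    show "y = z"
    proof
      fix i show "y i = z i"
        using * coord[of i y] coord[of i z] by (cases "i < n") (auto simp: topspace_Euclidean_space)
    qed
  qed
  moreover have "h ` U \<subseteq> topspace (Euclidean_space n)" "inj_on h U"
    using homeomorphic_imp_surjective_map[OF h] homeomorphic_imp_injective_map[OF h]
    unfolding UX by auto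
  ultimately have "inj_on f S"
    using \<phi>(2) \<open>S \<subseteq> W\<close> unfolding f_def
    by (intro comp_inj_on) (auto simp: S_def intro: inj_on_subset)
  have "continuous_on UNIV \<psi>"
    unfolding \<psi>_def by (intro continuous_intros continuous_on_product_coordinates)
  then have "continuous_map (Euclidean_space n) euclidean \<psi>"
    by (simp add: continuous_map_Euclidean_space_iff continuous_on_subset[OF _ subset_UNIV])
  moreover have "continuous_map (top_of_set S) (subtopology X U) \<phi>"
    using continuous_map_from_subtopology[OF \<phi>(1), of S] \<open>S \<subseteq> W\<close>
    by (auto simp: continuous_map_in_subtopology subtopology_subtopology inf.absorb2 S_def)
  moreover have "continuous_map (subtopology X U) (Euclidean_space n) h"
    using homeomorphic_imp_continuous_map[OF h] by (simp add: continuous_map_in_subtopology)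
  ultimately have "continuous_map (top_of_set S) euclidean f"
    unfolding f_def by (intro continuous_map_compose)
  then have "continuous_on S f"
    by simp
  moreover have "f \<in> S \<rightarrow> span B"
  proof
    fix x
    have "b i \<in> B" if "i < n" for i
      using b that by (auto simp: bij_betw_def)
    then show "f x \<in> span B"
      unfolding f_def \<psi>_def o_def by (intro span_sum span_scale span_base) auto
  qed
  ultimately have "dim W \<le> dim (span B)"
    using openS W \<open>inj_on f S\<close> 0 U(2)
    by (intro invariance_of_dimension_subspaces[of W S "span B" f]) (auto simp: S_def)
  also have "\<dots> \<le> n"
    using dim_le_card'[OF \<open>finite B\<close>] B(2) by simp
  finally show False
    using \<open>\<not> dim W \<le> n\<close> by simp
qed

text \<open>The Cayley transform maps \<open>k6 A\<close> injectively into the isometries, and is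
  Lipschitz for the uniform distance on the sphere.\<close>

lemma dim_le_manifold_dim_Iso_sub_H:
  assumes clifford: "clifford_family A" and n: "has_manifold_dim (Iso_sub_H_topology A) n"
  shows "dim (k6 A) \<le> n"
proof (rule has_manifold_dim_ge[OF n])
  let ?m = "cfunspace (top_of_set S7) (euclidean_metric :: (real^8) metric)"
  let ?\<phi> = "\<lambda>X. restrict ((*v) (cayley X)) S7"
  have k6: "X \<in> so" "X ** A 7 = A 7 ** X" if "X \<in> k6 A" for X
    using that k6_eq_centralizer[OF clifford] by auto
  show "subspace (k6 A)"
    by (simp add: k6_def)
  show "inj_on ?\<phi> (k6 A)"
  proof (rule inj_onI)
    fix X Y assume XY: "X \<in> k6 A" "Y \<in> k6 A" "?\<phi> X = ?\<phi> Y"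
    \<comment> \<open>The coordinate vectors lie on the sphere, so the restricted map still
      determines every column of the matrix.\<close>
    have "cayley X *v axis i 1 = cayley Y *v axis i 1" for i
      using fun_cong[OF XY(3), of "axis i 1"] by (simp add: norm_axis_1)
    then have "cayley X = cayley Y"
      by (simp add: vec_eq_iff matrix_vector_mult_basis column_def)
    then show "X = Y"
      using XY k6 inj_on_cayley by (metis inj_onD)
  qed
  have Iso: "?\<phi> X \<in> Iso_sub_H A" if "X \<in> k6 A" for X
    using Iso_sub_H_O8I[OF clifford orthogonal_matrix_cayley cayley_commute] k6[OF that]
    by (simp add: Iso_sub_H_O8_def)
  have space: "?\<phi> X \<in> mspace ?m" for X :: "real^8^8"
  proof -
    have "continuous_on S7 (?\<phi> X)"
      by (rule continuous_on_eq[OF linear_continuous_on[OF matrix_vector_mul_bounded_linear[of "cayley X"]]]) simp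
    then show ?thesis
      by (subst compactin_mspace_cfunspace) (auto simp: compactin_subtopology)
  qed
  obtain K where K: "\<And>(X :: real^8^8) Y q. X \<in> so \<Longrightarrow> Y \<in> so \<Longrightarrow>
    norm (cayley X *v q - cayley Y *v q) \<le> K * norm (X - Y) * norm q"
    using cayley_lipschitz by metis
  have "mdist ?m (?\<phi> X) (?\<phi> Y) \<le> \<bar>K\<bar> * dist X Y" if "X \<in> k6 A" "Y \<in> k6 A" for X Y
  proof (rule mdist_cfunspace_le)
    fix q assume q: "q \<in> topspace (top_of_set S7)"
    have "norm (cayley X *v q - cayley Y *v q) \<le> K * norm (X - Y) * norm q"
      using K that k6 by blast
    \<comment> \<open>The absolute value is taken because \<open>K\<close> comes without a sign; the
      factor 1 is the norm of \<open>q\<close>.\<close>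
    also have "\<dots> \<le> \<bar>K\<bar> * norm (X - Y) * 1"
      using q by (intro mult_mono) auto
    finally show "mdist euclidean_metric (?\<phi> X q) (?\<phi> Y q) \<le> \<bar>K\<bar> * dist X Y"
      using q by (simp add: dist_norm)
  qed simp
  then have "Lipschitz_continuous_map (submetric euclidean_metric (k6 A)) ?m ?\<phi>"
    unfolding Lipschitz_continuous_map_def using space by auto
  from Lipschitz_continuous_imp_continuous_map[OF this]
  show "continuous_map (top_of_set (k6 A)) (Iso_sub_H_topology A) ?\<phi>"
    unfolding Iso_sub_H_topology_def continuous_map_in_subtopology using Iso
    by (auto simp: mtopology_of_submetric)
qed

theorem theorem5p10:
  fixes A :: "nat \<Rightarrow> real^8^8"
  assumes "clifford_family A"
  shows "lie_algebra_of (Iso_sub_H_O8 A) = k6 A \<and> k6 A \<subseteq> so \<and> dim (k6 A) = 16 \<and>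
    (\<forall>n. has_manifold_dim (Iso_sub_H_topology A) n \<longrightarrow> n \<ge> dim (k6 A))"
  using lie_algebra_eq_centralizer[OF assms] k6_eq_centralizer[OF assms] dim_k6[OF assms]
    dim_le_manifold_dim_Iso_sub_H[OF assms]
  by blast

end
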